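(* Assume that the following statement (the overlaps conjecture) holds: for every finite non-empty free set $\Phi\subseteq\mathcal{S}$, the attractor $X$ of $\Phi$ satisfies $\dim X=\min\{1,s(\Phi)\}$. Then the following statement holds: if $X\subseteq\mathbb{R}$ is the attractor of an uncountable compact family $\Phi\subseteq\mathcal{S}$, then either $X$ is a single point or $\dim X=1$.
   Context: $G$ is the group of similarities (equivalently, invertible affine maps) $x\mapsto ax+b$, $a\neq 0$, of $\mathbb{R}$, with the topology given by the coordinates $(a,b)\in(\mathbb{R}\setminus\{0\})\times\mathbb{R}$. $\mathcal{S}\subseteq G$ is the semigroup of contracting similarities ($0<|a|<1$). For $\varphi(x)=ax+b$ write $\|\varphi\|=|a|$. For a compact non-empty $\Phi\subseteq\mathcal{S}$, the attractor of $\Phi$ is the unique non-empty compact set $X\subseteq\mathbb{R}$ with $X=\bigcup_{\varphi\in\Phi}\varphi(X)$. For finite $\Phi\subseteq\mathcal{S}$, the similarity dimension $s(\Phi)$ is the solution $s$ of $\sum_{\varphi\in\Phi}\|\varphi\|^{s}=1$. A set $\Phi\subseteq G$ is free if its elements freely generate a free semigroup: whenever $\varphi_1,\ldots,\varphi_m,\psi_1,\ldots,\psi_n\in\Phi$ and $\varphi_1\cdots\varphi_m=\psi_1\cdots\psi_n$, then $m=n$ and $\varphi_i=\psi_i$ for all $i$. $\dim$ denotes Hausdorff dimension. *)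

theory Defs
  imports "HOL-Analysis.Analysis" "HOL-Real_Asymp.Real_Asymp"
begin

section \<open>Similarities of the real line\<close>

text \<open>
  The pair \<open>(a, b)\<close> with \<open>a \<noteq> 0\<close> stands for the similarity \<open>x \<mapsto> a * x + b\<close>.  The topology on
  the group of similarities is then the subspace topology inherited from \<open>real \<times> real\<close>, and a
  set of similarities is compact in the group iff it is compact in \<open>real \<times> real\<close>.
\<close>

definition sim_map :: "real \<times> real \<Rightarrow> real \<Rightarrow> real" where
  "sim_map \<phi> = (\<lambda>x. fst \<phi> * x + snd \<phi>)"

definition sim_ratio :: "real \<times> real \<Rightarrow> real" where
  "sim_ratio \<phi> = \<bar>fst \<phi>\<bar>"

definition similarities :: "(real \<times> real) set" where
  "similarities = {\<phi>. fst \<phi> \<noteq> 0}"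

definition contractions :: "(real \<times> real) set" where
  "contractions = {\<phi> \<in> similarities. sim_ratio \<phi> < 1}"

lemma inj_sim_map: "inj sim_map"
proof (rule injI)
  fix \<phi> \<psi> :: "real \<times> real"
  assume "sim_map \<phi> = sim_map \<psi>"
  then have "sim_map \<phi> 0 = sim_map \<psi> 0" "sim_map \<phi> 1 = sim_map \<psi> 1"
    by simp_all
  then show "\<phi> = \<psi>"
    by (simp add: sim_map_def prod_eq_iff)
qed

lemma dist_sim_map: "dist (sim_map \<phi> x) (sim_map \<phi> y) = sim_ratio \<phi> * dist x y"
proof -
  have "sim_map \<phi> x - sim_map \<phi> y = fst \<phi> * (x - y)"
    by (simp add: sim_map_def algebra_simps)
  then show ?thesis
    by (simp add: dist_real_def sim_ratio_def abs_mult)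
qed

text \<open>Products in the group of similarities are compositions of maps.\<close>

definition word_map :: "(real \<times> real) list \<Rightarrow> real \<Rightarrow> real" where
  "word_map us = foldr (\<circ>) (map sim_map us) id"

definition free_set :: "(real \<times> real) set \<Rightarrow> bool" where
  "free_set \<Phi> \<longleftrightarrow>
    (\<forall>us vs. us \<noteq> [] \<longrightarrow> vs \<noteq> [] \<longrightarrow> set us \<subseteq> \<Phi> \<longrightarrow> set vs \<subseteq> \<Phi> \<longrightarrow>
       word_map us = word_map vs \<longrightarrow> us = vs)"


section \<open>Attractors and similarity dimension\<close>

definition is_attractor :: "(real \<times> real) set \<Rightarrow> real set \<Rightarrow> bool" where
  "is_attractor \<Phi> X \<longleftrightarrow> compact X \<and> X \<noteq> {} \<and> X = (\<Union>\<phi>\<in>\<Phi>. sim_map \<phi> ` X)"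

lemma is_attractor_unique:
  assumes \<Phi>: "\<Phi> \<subseteq> contractions" and X: "is_attractor \<Phi> X" and Y: "is_attractor \<Phi> Y"
  shows "X = Y"
proof -
  have *: "X \<subseteq> Y" if X: "is_attractor \<Phi> X" and Y: "is_attractor \<Phi> Y" for X Y
  proof -
    have cX: "compact X" "X \<noteq> {}" and cY: "compact Y" "Y \<noteq> {}"
      using X Y by (auto simp: is_attractor_def)
    have "continuous_on X (\<lambda>x. infdist x Y)"
      by (intro continuous_intros)
    then obtain x where x: "x \<in> X" and max: "\<And>z. z \<in> X \<Longrightarrow> infdist z Y \<le> infdist x Y"
      using continuous_attains_sup[OF cX] by blast
    obtain \<phi> x' where \<phi>: "\<phi> \<in> \<Phi>" "x' \<in> X" "x = sim_map \<phi> x'"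
      using X x unfolding is_attractor_def by blast
    obtain y' where y': "y' \<in> Y" "infdist x' Y = dist x' y'"
      using infdist_attains_inf[OF compact_imp_closed[OF cY(1)] cY(2)] by blast
    have "sim_map \<phi> y' \<in> Y"
      using Y y'(1) \<phi>(1) unfolding is_attractor_def by blast
    then have "infdist x Y \<le> dist x (sim_map \<phi> y')"
      by (rule infdist_le)
    also have "\<dots> = sim_ratio \<phi> * infdist x' Y"
      by (simp add: \<phi>(3) dist_sim_map y'(2))
    also have "\<dots> \<le> sim_ratio \<phi> * infdist x Y"
      by (rule mult_left_mono[OF max[OF \<phi>(2)]]) (simp add: sim_ratio_def)
    finally have "(1 - sim_ratio \<phi>) * infdist x Y \<le> 0"
      by (simp add: algebra_simps)
    moreover have "sim_ratio \<phi> < 1"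
      using \<Phi> \<phi>(1) by (auto simp: contractions_def)
    ultimately have "infdist x Y \<le> 0"
      by (simp add: mult_le_0_iff)
    then have "infdist z Y = 0" if "z \<in> X" for z
      using max[OF that] infdist_nonneg[of z Y] by linarith
    then show "X \<subseteq> Y"
      using in_closed_iff_infdist_zero[OF compact_imp_closed[OF cY(1)] cY(2)] by blast
  qed
  show ?thesis
    using *[OF X Y] *[OF Y X] by blast
qed

definition similarity_dim :: "(real \<times> real) set \<Rightarrow> real" where
  "similarity_dim \<Phi> = (THE s. (\<Sum>\<phi>\<in>\<Phi>. sim_ratio \<phi> powr s) = 1)"

lemma similarity_dim_ex1:
  assumes fin: "finite \<Phi>" and ne: "\<Phi> \<noteq> {}" and \<Phi>: "\<Phi> \<subseteq> contractions"
  shows "\<exists>!s. (\<Sum>\<phi>\<in>\<Phi>. sim_ratio \<phi> powr s) = 1"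
proof -
  define f where "f s = (\<Sum>\<phi>\<in>\<Phi>. sim_ratio \<phi> powr s)" for s
  have r: "0 < sim_ratio \<phi>" "sim_ratio \<phi> < 1" if "\<phi> \<in> \<Phi>" for \<phi>
    using \<Phi> that by (auto simp: contractions_def similarities_def sim_ratio_def)
  have mono: "f t < f s" if "s < t" for s t
    unfolding f_def using fin ne
    by (rule sum_strict_mono) (use r that in \<open>auto intro: powr_less_mono'\<close>)
  have cont: "continuous_on {0..b} f" for b
    unfolding f_def using r by (intro continuous_intros) force
  have "f 0 = card \<Phi>"
    unfolding f_def using r by (simp add: order_less_imp_not_eq2)
  then have f0: "1 \<le> f 0"
    using fin ne by (simp add: Suc_le_eq card_gt_0_iff)
  have "(f \<longlongrightarrow> (\<Sum>\<phi>\<in>\<Phi>. 0)) at_top"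
    unfolding f_def
  proof (rule tendsto_sum)
    fix \<phi> assume "\<phi> \<in> \<Phi>"
    then have "0 < sim_ratio \<phi>" "sim_ratio \<phi> < 1"
      using r by auto
    then show "((\<lambda>s. sim_ratio \<phi> powr s) \<longlongrightarrow> 0) at_top"
      by real_asymp
  qed
  then have "eventually (\<lambda>s. f s < 1) at_top"
    by (auto dest: order_tendstoD(2)[where a = 1])
  then obtain b where b: "0 \<le> b" "f b < 1"
    by (metis eventually_at_top_linorder nle_le)
  obtain s where "f s = 1"
    using IVT2'[of f b 1 0] b f0 cont by force
  moreover have "s = t" if "f s = 1" "f t = 1" for s t
    using mono[of s t] mono[of t s] that by (cases s t rule: linorder_cases) auto
  ultimately show ?thesis
    unfolding f_def by blast
qed


section \<open>Hausdorff dimension\<close>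

text \<open>
  The case distinction implements \<open>diam\<^sup>s\<close> with the usual conventions for \<open>s = 0\<close>, since
  \<open>0 powr 0 = 0\<close>.  The sets of a cover are required to be bounded because \<open>diameter\<close> is
  only meaningful for bounded sets.
\<close>

definition diam_power :: "real \<Rightarrow> 'a::metric_space set \<Rightarrow> ennreal" where
  "diam_power s U =
    (if U = {} then 0 else if s = 0 then 1 else ennreal (diameter U powr s))"

definition hausdorff_pre_measure :: "real \<Rightarrow> real \<Rightarrow> 'a::metric_space set \<Rightarrow> ennreal" where
  "hausdorff_pre_measure s \<delta> X =
    (INF U \<in> {U :: nat \<Rightarrow> 'a set. X \<subseteq> (\<Union>i. U i) \<and> (\<forall>i. bounded (U i) \<and> diameter (U i) \<le> \<delta>)}.
       \<Sum>i. diam_power s (U i))"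

definition hausdorff_measure :: "real \<Rightarrow> 'a::metric_space set \<Rightarrow> ennreal" where
  "hausdorff_measure s X = (SUP \<delta>\<in>{0<..}. hausdorff_pre_measure s \<delta> X)"

definition hausdorff_dim :: "'a::metric_space set \<Rightarrow> ereal" where
  "hausdorff_dim X = (INF s\<in>{s. 0 \<le> s \<and> hausdorff_measure s X = 0}. ereal s)"

end

(* It suffices to find, for some c > 0 and every N, a free set of N maps of ratio at least c in the
   semigroup generated by Phi: for N c >= 1 its attractor lies in X and has dimension 1 by the
   overlaps conjecture. Passing to odd powers (and composing with one map g if uncountably many maps
   share a fixed point) we may assume that all ratios are below 1/3 and that only countably many
   maps share any given fixed point. Fix an uncountable P such that every expression
   A(a) + B(a) b with polynomials A, B that vanishes at uncountably many (a, b) in P vanishes on all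
   of P. Choose the letters from P one after another, each outside countably many countable sets, so
   that a relation involving the last letter holds for every element of P in its place. Replacing
   it by an earlier letter reduces to relations between two letters, and these are excluded by
   strong separation. *)

theory Submission
  imports Defs "HOL-Computational_Algebra.Polynomial"
begin

section \<open>Hausdorff dimension of bounded subsets of the line\<close>

lemma hausdorff_measure_mono:
  assumes "X \<subseteq> Y"
  shows "hausdorff_measure s X \<le> hausdorff_measure s Y"
  unfolding hausdorff_measure_def hausdorff_pre_measure_def
  using assms by (intro SUP_mono' INF_superset_mono) auto

lemma hausdorff_dim_mono:
  assumes "X \<subseteq> Y"
  shows "hausdorff_dim X \<le> hausdorff_dim Y"
  unfolding hausdorff_dim_def
proof (rule INF_superset_mono)
  show "{s. 0 \<le> s \<and> hausdorff_measure s Y = 0} \<subseteq> {s. 0 \<le> s \<and> hausdorff_measure s X = 0}"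
    using hausdorff_measure_mono[OF assms] by (auto simp: le_zero_eq[symmetric] intro: order_trans simp del: le_zero_eq)
qed auto

lemma interval_subset_Union_grid:
  fixes M :: real
  assumes "M > 0" "n > 0"
  shows "{-M..M} \<subseteq> (\<Union>i\<le>n. {-M + 2*M/n*real i .. -M + 2*M/n*(real i+1)})"
proof
  fix x assume x: "x \<in> {-M..M}"
  define y where "y = (x + M) / (2*M/n)"
  have xy: "x = -M + 2*M/n*y"
    using assms by (simp add: y_def)
  have y0: "y \<ge> 0"
    using x assms by (simp add: y_def)
  have yn: "y \<le> n"
    using x assms by (simp add: y_def field_simps)
  \<comment> \<open>At the right end \<open>x = M\<close> this floor equals \<open>n\<close>, which
    is why the union has \<open>n + 1\<close> cells.\<close>
  define i where "i = nat \<lfloor>y\<rfloor>"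
  have i: "real i \<le> y" "y \<le> real i + 1"
    using y0 unfolding i_def by linarith+
  then have "i \<le> n" using yn by linarith
  moreover have "2*M/n*real i \<le> 2*M/n*y" "2*M/n*y \<le> 2*M/n*(real i+1)"
    using i assms by (intro mult_left_mono; simp)+
  ultimately show "x \<in> (\<Union>i\<le>n. {-M + 2*M/n*real i .. -M + 2*M/n*(real i+1)})"
    using xy by auto
qed

text \<open>Cover by the \<open>n + 1\<close> grid cells of length \<open>2*M/n\<close>. The bound
  is of order \<open>n powr (1 - s)\<close>, so it is useful for \<open>s > 1\<close>.\<close>

lemma hausdorff_pre_measure_grid:
  fixes X :: "real set"
  assumes X: "X \<subseteq> {-M..M}" and M: "M > 0" and n: "n > 0" "2*M/n \<le> \<delta>" and s: "s > 0"
  shows "hausdorff_pre_measure s \<delta> X \<le> ennreal (real (n+1) * (2*M/n) powr s)"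
proof -
  \<comment> \<open>Covers are infinite sequences; the empty sets that pad the grid contribute 0 by
    the convention in \<open>diam_power\<close>.\<close>
  define U where "U i = (if i \<le> n then {-M + 2*M/n*real i .. -M + 2*M/n*(real i+1)} else {})" for i :: nat
  have diam: "diameter {-M + 2*M/n*real i .. -M + 2*M/n*(real i+1)} = 2*M/n" for i :: nat
  proof -
    have "0 \<le> 2*M/n" using M by simp
    then show ?thesis by (subst diameter_closed_interval) (simp_all add: distrib_left)
  qed
  have "2*M/n \<ge> 0" using M by simp
  then have "\<delta> \<ge> 0" using n by linarith
  then have U: "bounded (U i) \<and> diameter (U i) \<le> \<delta>" for i
    using diam n by (auto simp: U_def)
  have "X \<subseteq> (\<Union>i. U i)"
  proof
    fix x assume "x \<in> X"
    then have "x \<in> (\<Union>i\<le>n. {-M + 2*M/n*real i .. -M + 2*M/n*(real i+1)})"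
      using X interval_subset_Union_grid[OF M n(1)] by blast
    then obtain i where "i \<le> n" "x \<in> {-M + 2*M/n*real i .. -M + 2*M/n*(real i+1)}"
      by blast
    then have "x \<in> U i" by (simp add: U_def)
    then show "x \<in> (\<Union>i. U i)" by blast
  qed
  then have "hausdorff_pre_measure s \<delta> X \<le> (\<Sum>i. diam_power s (U i))"
    unfolding hausdorff_pre_measure_def using U by (intro INF_lower) auto
  also have "\<dots> = (\<Sum>i\<le>n. diam_power s (U i))"
    by (rule suminf_finite) (auto simp: U_def diam_power_def)
  also have "\<dots> \<le> (\<Sum>i\<le>n. ennreal ((2*M/n) powr s))"
  proof (intro sum_mono)
    fix i assume "i \<in> {..n}"
    then have "diameter (U i) = 2*M/n" using diam by (simp add: U_def)
    then show "diam_power s (U i) \<le> ennreal ((2*M/n) powr s)"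
      using s by (simp add: diam_power_def)
  qed
  also have "\<dots> = ennreal (real (n+1) * (2*M/n) powr s)"
    by (simp add: ennreal_mult ennreal_of_nat_eq_real_of_nat)
  finally show ?thesis .
qed

text \<open>For \<open>s > 1\<close>, refining the grid forces every pre-measure to be 0; then
  \<open>s\<close> decreases to 1.\<close>

lemma hausdorff_dim_le_1:
  fixes X :: "real set"
  assumes "bounded X"
  shows "hausdorff_dim X \<le> 1"
proof -
  obtain M where M: "M > 0" "\<And>x. x \<in> X \<Longrightarrow> \<bar>x\<bar> \<le> M"
    using assms unfolding bounded_pos by auto
  then have X: "X \<subseteq> {-M..M}"
    by (auto simp: abs_le_iff) (smt (verit))
  have "hausdorff_measure s X = 0" if s: "s > 1" for s
  proof -
    have "hausdorff_pre_measure s \<delta> X = 0" if \<delta>: "\<delta> > 0" for \<delta>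
    proof -
      have "((\<lambda>n. real (n+1) * (2*M/real n) powr s) \<longlongrightarrow> 0) at_top"
        using s M by real_asymp
      then have lim: "((\<lambda>n. ennreal (real (n+1) * (2*M/real n) powr s)) \<longlongrightarrow> 0) at_top"
        by (metis ennreal_0 tendsto_ennrealI)
      have "((\<lambda>n. 2*M/real n) \<longlongrightarrow> 0) at_top"
        by real_asymp
      then have "eventually (\<lambda>n. 2*M/real n < \<delta>) at_top"
        using \<delta> by (rule order_tendstoD)
      then have "eventually (\<lambda>n. hausdorff_pre_measure s \<delta> X
          \<le> ennreal (real (n+1) * (2*M/real n) powr s)) at_top"
        using eventually_gt_at_top[of 0]
        by eventually_elim (use X M s in \<open>intro hausdorff_pre_measure_grid; simp\<close>)
      then have "hausdorff_pre_measure s \<delta> X \<le> 0"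
        using lim by (intro tendsto_lowerbound[OF lim]) auto
      then show ?thesis by simp
    qed
    then show ?thesis
      unfolding hausdorff_measure_def by simp
  qed
  then have le: "hausdorff_dim X \<le> ereal s" if "s > 1" for s
    unfolding hausdorff_dim_def using that by (intro INF_lower) auto
  show ?thesis
  proof (rule ereal_le_epsilon2)
    fix e :: real assume "0 < e"
    then show "hausdorff_dim X \<le> 1 + ereal e"
      using le[of "1 + e"] by (simp add: one_ereal_def)
  qed
qed


section \<open>Attractors of finite families and similarity dimension\<close>

lemma contractionsD:
  assumes "\<phi> \<in> contractions"
  shows "0 < sim_ratio \<phi>" "sim_ratio \<phi> < 1" "fst \<phi> \<noteq> 0" "\<bar>fst \<phi>\<bar> < 1"
  using assms by (auto simp: contractions_def similarities_def sim_ratio_def)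

lemma continuous_on_sim_map: "continuous_on S (sim_map \<phi>)"
  unfolding sim_map_def by (intro continuous_intros)

lemma contraction_fixed_point_in:
  assumes "\<psi> \<in> contractions" "compact X" "X \<noteq> {}" "sim_map \<psi> ` X \<subseteq> X"
  obtains t where "t \<in> X" "sim_map \<psi> t = t"
proof -
  have "\<exists>!x\<in>X. sim_map \<psi> x = x"
    using assms contractionsD[OF assms(1)]
    by (intro Banach_fix[where c = "sim_ratio \<psi>"]) (auto simp: compact_imp_complete dist_sim_map)
  then show ?thesis using that by blast
qed

text \<open>The attractor is the greatest fixed point of the Hutchinson operator inside \<open>X\<close>; its closure is
  again a post-fixed point, hence it is closed.\<close>

lemma finite_attractor_subset:
  assumes fin: "finite \<Psi>" and ne: "\<Psi> \<noteq> {}" and \<Psi>: "\<Psi> \<subseteq> contractions"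
    and X: "compact X" "X \<noteq> {}" and inv: "\<And>\<psi>. \<psi> \<in> \<Psi> \<Longrightarrow> sim_map \<psi> ` X \<subseteq> X"
  obtains Y where "is_attractor \<Psi> Y" "Y \<subseteq> X"
proof -
  define F where "F A = (\<Union>\<psi>\<in>\<Psi>. sim_map \<psi> ` A)" for A
  define Y where "Y = gfp (\<lambda>A. X \<inter> F A)"
  have mono: "mono (\<lambda>A. X \<inter> F A)"
    unfolding mono_def F_def by blast
  have Yeq: "Y = X \<inter> F Y"
    unfolding Y_def by (rule gfp_unfold[OF mono])
  then have YX: "Y \<subseteq> X" by blast
  then have "F Y \<subseteq> X"
    using inv unfolding F_def by blast
  then have FY: "F Y = Y" using Yeq by blast
  have upper: "A \<subseteq> Y" if "A \<subseteq> X" "A \<subseteq> F A" for A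
    unfolding Y_def using that by (intro gfp_upperbound) auto
  have cX: "closed X" using X(1) by (rule compact_imp_closed)
  have clX: "closure Y \<subseteq> X"
    using YX cX by (rule closure_minimal)
  then have cc: "compact (closure Y)"
    using bounded_subset[OF compact_imp_bounded[OF X(1)] YX] by (simp add: compact_closure)
  \<comment> \<open>Finiteness of \<open>\<Psi>\<close> enters here: a finite union of continuous
    images of a compact set is compact, hence closed.\<close>
  have "compact (F (closure Y))"
    unfolding F_def using fin cc by (intro compact_UN compact_continuous_image continuous_on_sim_map)
  moreover have "Y \<subseteq> F (closure Y)"
    using FY closure_subset[of Y] unfolding F_def by blast
  ultimately have "closure Y \<subseteq> F (closure Y)"
    by (intro closure_minimal compact_imp_closed)
  then have "closure Y \<subseteq> Y"
    using clX by (intro upper)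
  then have "compact Y"
    using cc closure_subset[of Y] by (metis subset_antisym)
  moreover have "Y \<noteq> {}"
  proof -
    obtain \<psi> where \<psi>: "\<psi> \<in> \<Psi>" using ne by blast
    obtain t where "t \<in> X" "sim_map \<psi> t = t"
      using contraction_fixed_point_in \<psi> \<Psi> X inv by (metis subsetD)
    \<comment> \<open>The singleton of a fixed point is contained in its own image under
      \<open>F\<close>, so it lies below the greatest fixed point.\<close>
    then have "{t} \<subseteq> Y"
      using \<psi> by (intro upper) (auto simp: F_def intro!: bexI[of _ \<psi>])
    then show ?thesis by blast
  qed
  ultimately have "is_attractor \<Psi> Y"
    using FY unfolding is_attractor_def F_def by simp
  then show ?thesis using that YX by blast
qed

text \<open>A ratio in (0, 1) grows strictly when its exponent drops from 1 to some
  \<open>s < 1\<close>, so a solution below 1 would make the sum at \<open>s\<close> exceed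
  1.\<close>

lemma similarity_dim_ge_1:
  assumes fin: "finite \<Psi>" and ne: "\<Psi> \<noteq> {}" and \<Psi>: "\<Psi> \<subseteq> contractions"
    and sum: "(\<Sum>\<psi>\<in>\<Psi>. sim_ratio \<psi>) \<ge> 1"
  shows "similarity_dim \<Psi> \<ge> 1"
proof (rule ccontr)
  define s where "s = similarity_dim \<Psi>"
  assume "\<not> similarity_dim \<Psi> \<ge> 1"
  then have s: "s < 1" by (simp add: s_def)
  have eq: "(\<Sum>\<psi>\<in>\<Psi>. sim_ratio \<psi> powr s) = 1"
    unfolding s_def similarity_dim_def by (rule theI'[OF similarity_dim_ex1[OF fin ne \<Psi>]])
  have "(\<Sum>\<psi>\<in>\<Psi>. sim_ratio \<psi>) < (\<Sum>\<psi>\<in>\<Psi>. sim_ratio \<psi> powr s)"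
  proof (rule sum_strict_mono[OF fin ne])
    fix \<psi> assume "\<psi> \<in> \<Psi>"
    then have "0 < sim_ratio \<psi>" "sim_ratio \<psi> < 1"
      using \<Psi> contractionsD by blast+
    then show "sim_ratio \<psi> < sim_ratio \<psi> powr s"
      using powr_less_mono'[of "sim_ratio \<psi>" s 1] s by simp
  qed
  then show False using eq sum by simp
qed


section \<open>Words and free sets\<close>

lemma word_map_Nil [simp]: "word_map [] = id"
  by (simp add: word_map_def)

lemma word_map_Cons [simp]: "word_map (\<phi> # us) x = sim_map \<phi> (word_map us x)"
  by (simp add: word_map_def)

text \<open>The outermost letter contracts strictly and the rest of the word does not expand. This
  serves to show that a non-empty word is never the identity.\<close>

lemma word_map_contracts:
  assumes "set us \<subseteq> contractions" "us \<noteq> []" "x \<noteq> y"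
  shows "dist (word_map us x) (word_map us y) < dist x y"
  using assms
proof (induction us)
  case (Cons \<phi> us)
  have r: "0 < sim_ratio \<phi>" "sim_ratio \<phi> < 1"
    using Cons.prems contractionsD by auto
  have le: "dist (word_map us x) (word_map us y) \<le> dist x y"
    using Cons by (cases "us = []") auto
  have "sim_ratio \<phi> * dist (word_map us x) (word_map us y) \<le> sim_ratio \<phi> * dist x y"
    using r le by (intro mult_left_mono) auto
  also have "\<dots> < dist x y"
    using r Cons.prems by simp
  finally show ?case by (simp add: dist_sim_map)
qed simp

text \<open>Freeness tested on first letters only; the tails may be empty. A relation can then be
  refuted after any substitution of letters that keeps the two first letters distinct.\<close>

definition prefix_free :: "(real \<times> real) set \<Rightarrow> bool" where
  "prefix_free S \<longleftrightarrow> (\<forall>x\<in>S. \<forall>y\<in>S. \<forall>us\<in>lists S. \<forall>vs\<in>lists S. x \<noteq> y \<longrightarrow>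
     word_map (x # us) \<noteq> word_map (y # vs))"

text \<open>Equal first letters cancel because similarities are injective, and distinct ones are
  excluded. Neither word can run out before the other, since a non-empty word is not the
  identity.\<close>

lemma prefix_free_imp_free_set:
  assumes S: "S \<subseteq> contractions" and pf: "prefix_free S"
  shows "free_set S"
proof -
  have nid: "word_map us \<noteq> id" if "us \<noteq> []" "set us \<subseteq> S" for us
    using word_map_contracts[of us 0 1] that S by (metis id_apply less_irrefl subset_trans zero_neq_one)
  have "us = vs" if "set us \<subseteq> S" "set vs \<subseteq> S" "word_map us = word_map vs" for us vs
    using that
  proof (induction us arbitrary: vs)
    case Nil
    then show ?case using nid[of vs] by (metis word_map_Nil)
  next
    case (Cons x us)
    then have "vs \<noteq> []" using nid[of "x # us"] by (metis list.distinct(1) word_map_Nil)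
    then obtain y vs' where vs: "vs = y # vs'" by (cases vs) auto
    have "x = y"
    proof (rule ccontr)
      assume "x \<noteq> y"
      then have "word_map (x # us) \<noteq> word_map (y # vs')"
        using pf Cons.prems(1,2) vs unfolding prefix_free_def by (simp add: lists_eq_set)
      then show False using Cons.prems(3) vs by metis
    qed
    have "fst x \<noteq> 0"
      using Cons.prems(1) S contractionsD(3)[of x] by auto
    then have "inj (sim_map x)"
      by (auto simp: inj_def sim_map_def)
    moreover have "sim_map x (word_map us z) = sim_map x (word_map vs' z)" for z
      using Cons.prems(3) \<open>x = y\<close> vs by (metis word_map_Cons)
    ultimately have "word_map us = word_map vs'"
      by (intro ext) (simp add: inj_eq)
    then show ?case
      using Cons vs \<open>x = y\<close> by auto
  qed
  then show ?thesis unfolding free_set_def by blast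
qed

definition fixed_point :: "real \<times> real \<Rightarrow> real" where
  "fixed_point \<phi> = snd \<phi> / (1 - fst \<phi>)"

lemma sim_map_fixed_point:
  assumes "fst \<phi> \<noteq> 1"
  shows "sim_map \<phi> x = fixed_point \<phi> + fst \<phi> * (x - fixed_point \<phi>)"
proof -
  have "snd \<phi> = fixed_point \<phi> * (1 - fst \<phi>)"
    using assms by (simp add: fixed_point_def)
  then show ?thesis by (simp add: sim_map_def algebra_simps)
qed

text \<open>Strong separation: with \<open>R\<close> the distance of the fixed points, the two maps send the points within
  \<open>3R/2\<close> of both fixed points into disjoint balls of radius \<open>R/2\<close>.\<close>

lemma prefix_free_pair:
  assumes small: "\<bar>fst \<phi>\<bar> < 1/3" "\<bar>fst \<psi>\<bar> < 1/3"
    and fp: "fixed_point \<phi> \<noteq> fixed_point \<psi>"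
  shows "prefix_free {\<phi>, \<psi>}"
proof -
  define R where "R = \<bar>fixed_point \<phi> - fixed_point \<psi>\<bar>"
  have R: "R > 0" using fp by (simp add: R_def)
  define N where "N = {x. \<bar>x - fixed_point \<phi>\<bar> < 3/2 * R \<and> \<bar>x - fixed_point \<psi>\<bar> < 3/2 * R}"
  have step: "\<bar>sim_map \<xi> x - fixed_point \<xi>\<bar> < R/2" if "\<xi> \<in> {\<phi>, \<psi>}" "x \<in> N" for \<xi> x
  proof -
    have "\<bar>fst \<xi>\<bar> < 1/3" "\<bar>x - fixed_point \<xi>\<bar> < 3/2 * R"
      using that small by (auto simp: N_def)
    then have "\<bar>fst \<xi>\<bar> * \<bar>x - fixed_point \<xi>\<bar> \<le> 1/3 * \<bar>x - fixed_point \<xi>\<bar>"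
      by (intro mult_right_mono) auto
    also have "\<dots> < R/2" using \<open>\<bar>x - fixed_point \<xi>\<bar> < 3/2 * R\<close> by simp
    finally show ?thesis
      using \<open>\<bar>fst \<xi>\<bar> < 1/3\<close> by (subst sim_map_fixed_point) (auto simp: abs_mult)
  qed
  have N: "x \<in> N" if "\<xi> \<in> {\<phi>, \<psi>}" "\<bar>x - fixed_point \<xi>\<bar> < R/2" for \<xi> x
  proof -
    have "\<bar>x - fixed_point \<phi>\<bar> < R/2 \<or> \<bar>x - fixed_point \<psi>\<bar> < R/2"
      using that by auto
    moreover have "\<bar>x - fixed_point \<phi>\<bar> \<le> \<bar>x - fixed_point \<psi>\<bar> + R"
      "\<bar>x - fixed_point \<psi>\<bar> \<le> \<bar>x - fixed_point \<phi>\<bar> + R"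
      unfolding R_def by linarith+
    ultimately have "\<bar>x - fixed_point \<phi>\<bar> < 3/2 * R \<and> \<bar>x - fixed_point \<psi>\<bar> < 3/2 * R"
      by linarith
    then show ?thesis by (simp add: N_def)
  qed
  have words: "word_map us (fixed_point \<phi>) \<in> N" if "us \<in> lists {\<phi>, \<psi>}" for us
    using that
  proof (induction us)
    case Nil
    show ?case using R by (simp add: N_def R_def)
  next
    case (Cons \<xi> us)
    then show ?case using N step by (metis word_map_Cons)
  qed
  show ?thesis
    unfolding prefix_free_def
  proof (intro ballI impI notI)
    fix x y us vs
    assume xy: "x \<in> {\<phi>, \<psi>}" "y \<in> {\<phi>, \<psi>}" "x \<noteq> y"
      and w: "us \<in> lists {\<phi>, \<psi>}" "vs \<in> lists {\<phi>, \<psi>}"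
      and eq: "word_map (x # us) = word_map (y # vs)"
    define z where "z = word_map (x # us) (fixed_point \<phi>)"
    have "\<bar>z - fixed_point x\<bar> < R/2" "\<bar>z - fixed_point y\<bar> < R/2"
      using step[OF xy(1) words[OF w(1)]] step[OF xy(2) words[OF w(2)]] eq
      unfolding z_def by (metis word_map_Cons)+
    then show False
      using xy abs_triangle_ineq4[of "z - fixed_point \<psi>" "z - fixed_point \<phi>"]
      unfolding R_def by auto
  qed
qed


section \<open>Irreducible uncountable sets\<close>

text \<open>Evaluating a word at a given real number gives such an expression in any one of its letters \<open>(a, b)\<close>.\<close>

definition hval :: "real poly \<Rightarrow> real poly \<Rightarrow> real \<times> real \<Rightarrow> real" where
  "hval A B \<phi> = poly A (fst \<phi>) + poly B (fst \<phi>) * snd \<phi>"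

text \<open>An analogue of irreducibility of a curve, with countable sets as the negligible ones: an
  expression \<open>hval A B\<close> vanishes either everywhere on \<open>P\<close> or at only
  countably many points.\<close>

definition irreducible_set :: "(real \<times> real) set \<Rightarrow> bool" where
  "irreducible_set P \<longleftrightarrow>
     (\<forall>A B. uncountable {\<phi>\<in>P. hval A B \<phi> = 0} \<longrightarrow> (\<forall>\<phi>\<in>P. hval A B \<phi> = 0))"

lemma irreducible_setD:
  assumes "irreducible_set P" "uncountable {\<phi>\<in>P. hval A B \<phi> = 0}" "\<phi> \<in> P"
  shows "hval A B \<phi> = 0"
  using assms unfolding irreducible_set_def by blast

lemma uncountable_diff_countable_ex:
  assumes "uncountable A" "countable B"
  shows "\<exists>x\<in>A. x \<notin> B"
  using assms by (meson countable_subset subsetI)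

text \<open>Three cases: an uncountable vertical fibre works; otherwise an uncountable piece of a
  graph \<open>b = - A(a) / B(a)\<close> works, if some nontrivial expression vanishes uncountably
  often; otherwise \<open>\<Phi>\<close> itself works.\<close>

lemma irreducible_subset_exists:
  fixes \<Phi> :: "(real \<times> real) set"
  assumes unc: "uncountable \<Phi>"
  obtains P where "P \<subseteq> \<Phi>" "uncountable P" "irreducible_set P"
proof (cases "\<exists>a. uncountable {\<phi>\<in>\<Phi>. fst \<phi> = a}")
  case True
  then obtain a where a: "uncountable {\<phi>\<in>\<Phi>. fst \<phi> = a}" (is "uncountable ?P") by blast
  have "irreducible_set ?P"
    unfolding irreducible_set_def
  proof (intro allI impI)
    fix A B
    assume u: "uncountable {\<phi>\<in>?P. hval A B \<phi> = 0}" (is "uncountable ?Z")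
    then obtain \<phi> where \<phi>: "\<phi> \<in> ?Z"
      using uncountable_diff_countable_ex[of ?Z "{}"] by blast
    obtain \<psi> where \<psi>: "\<psi> \<in> ?Z" "\<psi> \<noteq> \<phi>"
      using uncountable_diff_countable_ex[OF u, of "{\<phi>}"] by blast
    \<comment> \<open>On a fibre the expression is affine in the second coordinate, so two zeros
      make both coefficients vanish.\<close>
    have "snd \<phi> \<noteq> snd \<psi>"
      using \<phi> \<psi> by (auto simp: prod_eq_iff)
    moreover have eq: "poly A a + poly B a * snd \<phi> = 0" "poly A a + poly B a * snd \<psi> = 0"
      using \<phi> \<psi> by (auto simp: hval_def)
    ultimately have "poly B a = 0"
      by (metis add_left_cancel mult_cancel_left)
    moreover from this have "poly A a = 0"
      using eq(1) by simp
    ultimately show "\<forall>\<phi>\<in>?P. hval A B \<phi> = 0"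
      by (auto simp: hval_def)
  qed
  then show ?thesis using that[of ?P] a by blast
next
  case False
  then have fib: "countable {\<phi>\<in>\<Phi>. fst \<phi> = a}" for a by blast
  \<comment> \<open>A nonzero polynomial has finitely many roots, and each root carries a countable
    fibre.\<close>
  have cnt: "countable {\<phi>\<in>\<Phi>. poly C (fst \<phi>) = 0}" if "C \<noteq> 0" for C
  proof -
    have "{\<phi>\<in>\<Phi>. poly C (fst \<phi>) = 0} = (\<Union>a\<in>{a. poly C a = 0}. {\<phi>\<in>\<Phi>. fst \<phi> = a})"
      by auto
    then show ?thesis
      using poly_roots_finite[OF that] fib by (simp add: countable_finite)
  qed
  show ?thesis
  proof (cases "\<exists>A B. uncountable {\<phi>\<in>\<Phi>. hval A B \<phi> = 0} \<and> \<not> (A = 0 \<and> B = 0)")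
    case True
    then obtain A B where AB: "uncountable {\<phi>\<in>\<Phi>. hval A B \<phi> = 0}" "\<not> (A = 0 \<and> B = 0)"
      by blast
    have B: "B \<noteq> 0"
      using AB cnt[of A] by (auto simp: hval_def)
    \<comment> \<open>Discarding the zeros of \<open>B\<close> costs only countably many points and
      makes the second coordinate a function of the first.\<close>
    define P where "P = {\<phi>\<in>\<Phi>. hval A B \<phi> = 0} - {\<phi>\<in>\<Phi>. poly B (fst \<phi>) = 0}"
    have "uncountable P"
      unfolding P_def using AB(1) cnt[OF B] by (rule uncountable_minus_countable)
    moreover have "irreducible_set P"
      unfolding irreducible_set_def
    proof (intro allI impI)
      fix C D
      assume u: "uncountable {\<phi>\<in>P. hval C D \<phi> = 0}" (is "uncountable ?Z")
      \<comment> \<open>Eliminating the second coordinate turns a further expression into a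
        polynomial in the first one alone, to which \<open>cnt\<close> applies.\<close>
      have elim: "poly (C * B - D * A) (fst \<phi>) = poly B (fst \<phi>) * hval C D \<phi>" if "\<phi> \<in> P" for \<phi>
      proof -
        have "poly A (fst \<phi>) = - poly B (fst \<phi>) * snd \<phi>"
          using that by (simp add: P_def hval_def)
        then show ?thesis by (simp add: hval_def algebra_simps)
      qed
      have "?Z \<subseteq> {\<phi>\<in>\<Phi>. poly (C * B - D * A) (fst \<phi>) = 0}"
      proof
        fix \<phi> assume "\<phi> \<in> ?Z"
        then show "\<phi> \<in> {\<phi>\<in>\<Phi>. poly (C * B - D * A) (fst \<phi>) = 0}"
          using elim[of \<phi>] unfolding P_def by simp
      qed
      then have "C * B - D * A = 0"
        using u cnt countable_subset by blast
      then show "\<forall>\<phi>\<in>P. hval C D \<phi> = 0"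
        using elim by (auto simp: P_def)
    qed
    ultimately show ?thesis using that[of P] by (auto simp: P_def)
  next
    case False
    then have "irreducible_set \<Phi>"
      unfolding irreducible_set_def
    proof (intro allI impI ballI)
      fix A B \<phi> assume "uncountable {\<phi>\<in>\<Phi>. hval A B \<phi> = 0}"
      then have "A = 0 \<and> B = 0" using False by blast
      then show "hval A B \<phi> = 0" by (simp add: hval_def)
    qed
    then show ?thesis using that unc by blast
  qed
qed


section \<open>Large free sets\<close>

text \<open>In the patterns below, \<open>None\<close> is a placeholder for the letter to be substituted.\<close>

lemma word_map_pattern_hval:
  "\<exists>A B. \<forall>\<psi>. word_map (map (case_option \<psi> id) us) x = hval A B \<psi>"
proof (induction us)
  case Nil
  show ?case by (intro exI[of _ "[:x:]"] exI[of _ 0]) (simp add: hval_def)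
next
  case (Cons l us)
  then obtain A B where AB: "\<And>\<psi>. word_map (map (case_option \<psi> id) us) x = hval A B \<psi>"
    by blast
  show ?case
  proof (cases l)
    case None
    \<comment> \<open>Here \<open>[:0, 1:]\<close> is the variable \<open>a\<close>. Prepending the
      unknown letter multiplies by \<open>a\<close> and adds \<open>b\<close>, so the value stays
      affine in \<open>b\<close> even if the letter occurs repeatedly.\<close>
    show ?thesis
      by (intro exI[of _ "[:0, 1:] * A"] exI[of _ "[:0, 1:] * B + 1"])
         (simp add: None AB hval_def sim_map_def algebra_simps)
  next
    case (Some \<xi>)
    show ?thesis
      by (intro exI[of _ "smult (fst \<xi>) A + [:snd \<xi>:]"] exI[of _ "smult (fst \<xi>) B"])
         (simp add: Some AB hval_def sim_map_def algebra_simps)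
  qed
qed

text \<open>At each point \<open>x\<close> the difference of the two sides is an expression
  \<open>hval\<close> in the substituted letter, so irreducibility applies pointwise.\<close>

lemma irreducible_word_relation:
  assumes P: "irreducible_set P"
    and unc: "uncountable {\<psi>\<in>P. word_map (map (case_option \<psi> id) us) = word_map (map (case_option \<psi> id) vs)}"
    and \<psi>: "\<psi> \<in> P"
  shows "word_map (map (case_option \<psi> id) us) = word_map (map (case_option \<psi> id) vs)"
proof
  fix x
  obtain A B where A: "\<And>\<psi>. word_map (map (case_option \<psi> id) us) x = hval A B \<psi>"
    using word_map_pattern_hval by blast
  obtain C D where C: "\<And>\<psi>. word_map (map (case_option \<psi> id) vs) x = hval C D \<psi>"
    using word_map_pattern_hval by blast
  have diff: "hval (A - C) (B - D) \<psi> = hval A B \<psi> - hval C D \<psi>" for \<psi>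
    by (simp add: hval_def algebra_simps)
  have "{\<psi>\<in>P. word_map (map (case_option \<psi> id) us) = word_map (map (case_option \<psi> id) vs)}
      \<subseteq> {\<psi>\<in>P. hval (A - C) (B - D) \<psi> = 0}"
    using A C diff by auto (metis)
  then have "uncountable {\<psi>\<in>P. hval (A - C) (B - D) \<psi> = 0}"
    using unc countable_subset by blast
  from irreducible_setD[OF P this \<psi>]
  show "word_map (map (case_option \<psi> id) us) x = word_map (map (case_option \<psi> id) vs) x"
    using A C diff by simp
qed

text \<open>A letter outside countably many countable sets satisfies only relations that hold identically on
  \<open>P\<close>; substituting an old letter for it would give a relation in \<open>S\<close>, or, if \<open>S\<close> has a single letter,
  in a prefix-free pair.\<close>

lemma prefix_free_insert:
  assumes P: "uncountable P" "irreducible_set P" and S: "S \<subseteq> P" "finite S" "S \<noteq> {}"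
    and pf: "prefix_free S"
    and pair: "\<And>x. x \<in> P \<Longrightarrow> \<exists>y\<in>P. y \<noteq> x \<and> prefix_free {x, y}"
  obtains \<phi> where "\<phi> \<in> P" "\<phi> \<notin> S" "prefix_free (insert \<phi> S)"
proof -
  define L where "L = lists (insert None (Some ` S))"
  define Z where "Z us vs = {\<psi>\<in>P. word_map (map (case_option \<psi> id) us) = word_map (map (case_option \<psi> id) vs)}"
    for us vs
  have "countable L"
    unfolding L_def using S by (simp add: countable_finite)
  then have "countable (\<Union>(us, vs)\<in>{(us, vs)\<in>L \<times> L. countable (Z us vs)}. Z us vs)"
  proof (intro countable_UN)
    show "countable {(us, vs)\<in>L \<times> L. countable (Z us vs)}"
      by (rule countable_subset[OF _ countable_SIGMA[OF \<open>countable L\<close> \<open>countable L\<close>]]) auto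
  qed auto
  then have "countable (S \<union> (\<Union>(us, vs)\<in>{(us, vs)\<in>L \<times> L. countable (Z us vs)}. Z us vs))"
    using S(2) by (simp add: countable_finite)
  from uncountable_diff_countable_ex[OF P(1) this]
  obtain \<phi> where \<phi>: "\<phi> \<in> P" "\<phi> \<notin> S"
    and gen: "\<And>us vs. us \<in> L \<Longrightarrow> vs \<in> L \<Longrightarrow> \<phi> \<in> Z us vs \<Longrightarrow> uncountable (Z us vs)"
    by blast
  \<comment> \<open>\<open>p\<close> replaces \<open>\<phi>\<close> by the placeholder and
    \<open>sub \<psi>\<close> fills it with \<open>\<psi>\<close>; filling it with
    \<open>\<phi>\<close> restores the word.\<close>
  define p where "p x = (if x = \<phi> then None else Some x)" for x
  define sub where "sub \<psi> x = (if x = \<phi> then \<psi> else x)" for \<psi> x :: "real \<times> real"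
  have p: "map (case_option \<psi> id) (map p us) = map (sub \<psi>) us" for \<psi> us
    by (auto simp: p_def sub_def)
  have subst: "word_map (map (sub \<psi>) us) = word_map (map (sub \<psi>) vs)"
    if us: "us \<in> lists (insert \<phi> S)" "vs \<in> lists (insert \<phi> S)" and eq: "word_map us = word_map vs"
      and \<psi>: "\<psi> \<in> P" for us vs \<psi>
  proof -
    have "map (sub \<phi>) us = us" for us
      by (rule map_idI) (simp add: sub_def)
    then have "\<phi> \<in> Z (map p us) (map p vs)"
      unfolding Z_def p using \<phi> eq by simp
    moreover have "map p us \<in> L" "map p vs \<in> L"
      using us unfolding L_def by (auto simp: p_def lists_eq_set)
    ultimately have "uncountable (Z (map p us) (map p vs))"
      using gen by blast
    then show ?thesis
      using irreducible_word_relation[OF P(2) _ \<psi>, of "map p us" "map p vs"]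
      unfolding Z_def p by blast
  qed
  have "prefix_free (insert \<phi> S)"
    unfolding prefix_free_def
  proof (intro ballI impI notI)
    fix x y us vs
    assume xy: "x \<in> insert \<phi> S" "y \<in> insert \<phi> S" "x \<noteq> y"
      and w: "us \<in> lists (insert \<phi> S)" "vs \<in> lists (insert \<phi> S)"
      and eq: "word_map (x # us) = word_map (y # vs)"
    \<comment> \<open>The substituted relation has its letters in \<open>T\<close>; it contradicts
      prefix-freeness as soon as \<open>\<psi>\<close> keeps the first letters apart.\<close>
    obtain T \<psi> where T: "prefix_free T" "S \<subseteq> T" "\<psi> \<in> T" "\<psi> \<in> P" "sub \<psi> x \<noteq> sub \<psi> y"
    proof (cases "\<exists>\<psi>\<in>S. sub \<psi> x \<noteq> sub \<psi> y")
      case True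
      then show ?thesis using that[of S] pf S by blast
    next
      case False
      \<comment> \<open>One first letter is new and the other is an old letter \<open>z\<close>.
        Only \<open>\<psi> = z\<close> identifies them, so failure for all of \<open>S\<close> means
        that \<open>z\<close> is its only element.\<close>
      have "x = \<phi> \<or> y = \<phi>"
        using False xy(3) S(3) unfolding sub_def by force
      then obtain z where z: "z \<in> S" "x = \<phi> \<and> y = z \<or> x = z \<and> y = \<phi>"
        using xy by blast
      have z\<phi>: "z \<noteq> \<phi>"
        using z(1) \<phi>(2) by metis
      have Sz: "S \<subseteq> {z}"
      proof
        fix \<psi> assume "\<psi> \<in> S"
        then have "sub \<psi> x = sub \<psi> y" using False by metis
        then show "\<psi> \<in> {z}" using z(2) z\<phi> unfolding sub_def by auto
      qed
      obtain \<psi> where \<psi>: "\<psi> \<in> P" "\<psi> \<noteq> z" "prefix_free {z, \<psi>}"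
        using pair z(1) S(1) by blast
      have "sub \<psi> x \<noteq> sub \<psi> y"
        using z(2) z\<phi> \<psi>(2) unfolding sub_def by auto
      then show ?thesis using that[of "{z, \<psi>}" \<psi>] \<psi> Sz by blast
    qed
    have inT: "sub \<psi> z \<in> T" if "z \<in> insert \<phi> S" for z
      using that T by (auto simp: sub_def)
    have "map (sub \<psi>) us \<in> lists T" "map (sub \<psi>) vs \<in> lists T"
      using w inT by (auto simp: lists_eq_set)
    moreover have "word_map (sub \<psi> x # map (sub \<psi>) us) = word_map (sub \<psi> y # map (sub \<psi>) vs)"
      using subst[of "x # us" "y # vs" \<psi>] xy w eq T by simp
    ultimately show False
      using T inT xy unfolding prefix_free_def by blast
  qed
  then show ?thesis using that \<phi> by blast
qed

text \<open>Letters are added one at a time to a singleton, which is vacuously prefix-free.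
  Countability of the fixed-point fibres gives every letter a partner with another fixed point, as
  strong separation requires.\<close>

lemma large_free_subset:
  fixes \<Phi> :: "(real \<times> real) set"
  assumes unc: "uncountable \<Phi>" and con: "\<Phi> \<subseteq> contractions"
    and small: "\<And>\<phi>. \<phi> \<in> \<Phi> \<Longrightarrow> sim_ratio \<phi> < 1/3"
    and fp: "\<And>t. countable {\<phi>\<in>\<Phi>. fixed_point \<phi> = t}"
  shows "\<exists>S. S \<subseteq> \<Phi> \<and> finite S \<and> card S = Suc n \<and> free_set S"
proof -
  obtain P where P: "P \<subseteq> \<Phi>" "uncountable P" "irreducible_set P"
    using irreducible_subset_exists[OF unc] by blast
  have pair: "\<exists>y\<in>P. y \<noteq> x \<and> prefix_free {x, y}" if x: "x \<in> P" for x
  proof -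
    have "countable {\<phi>\<in>P. fixed_point \<phi> = fixed_point x}"
      using P(1) by (intro countable_subset[OF _ fp[of "fixed_point x"]]) auto
    from uncountable_diff_countable_ex[OF P(2) this]
    obtain y where y: "y \<in> P" "fixed_point y \<noteq> fixed_point x"
      by blast
    have "prefix_free {x, y}"
      using small[of x] small[of y] x y P by (intro prefix_free_pair) (auto simp: sim_ratio_def)
    then show ?thesis using y by metis
  qed
  have "\<exists>S. S \<subseteq> P \<and> finite S \<and> card S = Suc n \<and> prefix_free S"
  proof (induction n)
    case 0
    obtain x where "x \<in> P" using P(2) by (metis countable_empty ex_in_conv)
    then show ?case by (intro exI[of _ "{x}"]) (auto simp: prefix_free_def)
  next
    case (Suc n)
    then obtain S where S: "S \<subseteq> P" "finite S" "card S = Suc n" "prefix_free S" by blast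
    then have "S \<noteq> {}" by auto
    obtain \<phi> where "\<phi> \<in> P" "\<phi> \<notin> S" "prefix_free (insert \<phi> S)"
      using prefix_free_insert[OF P(2,3) S(1,2) \<open>S \<noteq> {}\<close> S(4) pair] by blast
    then show ?case using S by (intro exI[of _ "insert \<phi> S"]) auto
  qed
  then obtain S where "S \<subseteq> P" "finite S" "card S = Suc n" "prefix_free S" by blast
  then show ?thesis
    using prefix_free_imp_free_set[of S] P con by (intro exI[of _ S]) auto
qed


section \<open>Powers and compositions of contractions\<close>

definition sim_comp :: "real \<times> real \<Rightarrow> real \<times> real \<Rightarrow> real \<times> real" where
  "sim_comp \<phi> \<psi> = (fst \<phi> * fst \<psi>, fst \<phi> * snd \<psi> + snd \<phi>)"

text \<open>Closed form of the iterate: for \<open>fst \<phi> \<noteq> 1\<close>, the homothety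
  about the fixed point of \<open>\<phi>\<close> with the factor raised to the power
  \<open>n\<close>.\<close>

definition sim_power :: "nat \<Rightarrow> real \<times> real \<Rightarrow> real \<times> real" where
  "sim_power n \<phi> = (fst \<phi> ^ n, fixed_point \<phi> * (1 - fst \<phi> ^ n))"

lemma sim_map_comp: "sim_map (sim_comp \<phi> \<psi>) x = sim_map \<phi> (sim_map \<psi> x)"
  by (simp add: sim_map_def sim_comp_def algebra_simps)

lemma sim_ratio_comp: "sim_ratio (sim_comp \<phi> \<psi>) = sim_ratio \<phi> * sim_ratio \<psi>"
  by (simp add: sim_ratio_def sim_comp_def abs_mult)

lemma sim_ratio_power: "sim_ratio (sim_power n \<phi>) = sim_ratio \<phi> ^ n"
  by (simp add: sim_ratio_def sim_power_def power_abs)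

lemma sim_map_power:
  assumes "fst \<phi> \<noteq> 1"
  shows "sim_map (sim_power n \<phi>) x = (sim_map \<phi> ^^ n) x"
proof (induction n)
  case 0
  show ?case by (simp add: sim_map_def sim_power_def)
next
  case (Suc n)
  have "sim_map (sim_power (Suc n) \<phi>) x = sim_map \<phi> (sim_map (sim_power n \<phi>) x)"
    unfolding sim_map_fixed_point[OF assms] by (simp add: sim_map_def sim_power_def algebra_simps)
  then show ?case using Suc by simp
qed

lemma contractions_iff: "\<phi> \<in> contractions \<longleftrightarrow> 0 < sim_ratio \<phi> \<and> sim_ratio \<phi> < 1"
  by (auto simp: contractions_def similarities_def sim_ratio_def)

lemma sim_power_contraction:
  assumes "\<phi> \<in> contractions" "n > 0"
  shows "sim_power n \<phi> \<in> contractions"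
  using assms by (simp add: contractions_iff sim_ratio_power power_less_one_iff)

lemma fixed_point_sim_power:
  assumes "\<phi> \<in> contractions" "n > 0"
  shows "fixed_point (sim_power n \<phi>) = fixed_point \<phi>"
proof -
  have "\<bar>fst \<phi> ^ n\<bar> < 1"
    using assms contractionsD(4)[of \<phi>] by (simp add: power_abs power_less_one_iff)
  then have "1 - fst \<phi> ^ n \<noteq> 0" by auto
  then show ?thesis
    unfolding fixed_point_def[of "sim_power n \<phi>"] by (simp add: sim_power_def)
qed

text \<open>Parity matters: \<open>x \<mapsto> - a * x\<close> and \<open>x \<mapsto> a * x\<close> have the same square.\<close>

lemma inj_on_sim_power:
  assumes "odd n"
  shows "inj_on (sim_power n) contractions"
proof (rule inj_onI)
  fix \<phi> \<psi> assume *: "\<phi> \<in> contractions" "\<psi> \<in> contractions" "sim_power n \<phi> = sim_power n \<psi>"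
  have n: "n > 0" using assms by (rule odd_pos)
  have "fst \<phi> ^ n = fst \<psi> ^ n"
    using *(3) by (simp add: sim_power_def)
  then have a: "fst \<phi> = fst \<psi>"
    using odd_real_root_power_cancel[OF assms] by metis
  have "fixed_point \<phi> = fixed_point \<psi>"
    using * fixed_point_sim_power n by metis
  moreover have "fst \<phi> \<noteq> 1" using contractionsD[OF *(1)] by auto
  ultimately have "snd \<phi> = snd \<psi>" using a by (simp add: fixed_point_def)
  then show "\<phi> = \<psi>" using a by (simp add: prod_eq_iff)
qed

lemma sim_map_eq_fixed_point_iff:
  assumes "\<phi> \<in> contractions"
  shows "sim_map \<phi> x = x \<longleftrightarrow> x = fixed_point \<phi>"
proof -
  have "fst \<phi> \<noteq> 1" using contractionsD[OF assms] by auto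
  then show ?thesis by (auto simp: sim_map_def fixed_point_def field_simps)
qed

text \<open>At the common fixed point \<open>u\<close> of the compositions, cancelling
  \<open>g\<close> shows that \<open>\<phi>\<close> and \<open>\<psi>\<close> agree. As
  \<open>g\<close> moves \<open>t\<close>, \<open>u\<close> differs from \<open>t\<close>, and two
  homotheties about \<open>t\<close> agreeing at another point are equal.\<close>

lemma fixed_point_comp_inj:
  assumes g: "g \<in> contractions" "fixed_point g \<noteq> t"
    and \<phi>: "\<phi> \<in> contractions" "fixed_point \<phi> = t" and \<psi>: "\<psi> \<in> contractions" "fixed_point \<psi> = t"
    and eq: "fixed_point (sim_comp g \<phi>) = fixed_point (sim_comp g \<psi>)"
  shows "\<phi> = \<psi>"
proof -
  define u where "u = fixed_point (sim_comp g \<phi>)"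
  have c: "sim_comp g \<phi> \<in> contractions" "sim_comp g \<psi> \<in> contractions"
    using g(1) \<phi>(1) \<psi>(1) mult_strict_mono[of "sim_ratio g" 1 _ 1]
    by (simp_all add: contractions_iff sim_ratio_comp)
  have "sim_map g (sim_map \<phi> u) = u" "sim_map g (sim_map \<psi> u) = u"
    using sim_map_eq_fixed_point_iff[OF c(1)] sim_map_eq_fixed_point_iff[OF c(2)] eq
    unfolding u_def by (metis sim_map_comp)+
  moreover have "fst g \<noteq> 0" using g contractionsD by blast
  ultimately have uu: "sim_map \<phi> u = sim_map \<psi> u"
    unfolding sim_map_def[of g] by (metis add_right_cancel mult_left_cancel)
  have ne1: "fst \<phi> \<noteq> 1" "fst \<psi> \<noteq> 1"
    using contractionsD[OF \<phi>(1)] contractionsD[OF \<psi>(1)] by auto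
  have "u \<noteq> t"
  proof
    assume "u = t"
    then have "sim_map g t = t"
      using \<open>sim_map g (sim_map \<phi> u) = u\<close> \<phi> sim_map_eq_fixed_point_iff by metis
    then show False using g sim_map_eq_fixed_point_iff by metis
  qed
  moreover have "fst \<phi> * (u - t) = fst \<psi> * (u - t)"
    using uu sim_map_fixed_point[OF ne1(1)] sim_map_fixed_point[OF ne1(2)] \<phi> \<psi> by simp
  ultimately have a: "fst \<phi> = fst \<psi>" by simp
  then have "snd \<phi> = snd \<psi>"
    using ne1 \<phi> \<psi> by (auto simp: fixed_point_def)
  then show ?thesis using a by (simp add: prod_eq_iff)
qed


section \<open>Reduction to small contractions\<close>

text \<open>By compactness the extreme ratios are attained, so one power brings all ratios below 1/3
  and keeps them away from 0. If uncountably many powers still share a fixed point, composing these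
  with a map that moves it separates their fixed points.\<close>

lemma uncountable_small_family:
  assumes con: "\<Phi> \<subseteq> contractions" and comp: "compact \<Phi>" and unc: "uncountable \<Phi>"
    and inv: "\<And>\<phi>. \<phi> \<in> \<Phi> \<Longrightarrow> sim_map \<phi> ` X \<subseteq> X"
    and nofix: "\<And>t. \<exists>g\<in>\<Phi>. fixed_point g \<noteq> t"
  obtains \<Theta> c where "uncountable \<Theta>" "\<Theta> \<subseteq> contractions" "c > 0"
    "\<forall>\<theta>\<in>\<Theta>. c \<le> sim_ratio \<theta> \<and> sim_ratio \<theta> < 1/3"
    "\<forall>\<theta>\<in>\<Theta>. sim_map \<theta> ` X \<subseteq> X"
    "\<forall>t. countable {\<theta>\<in>\<Theta>. fixed_point \<theta> = t}"
proof -
  have ne: "\<Phi> \<noteq> {}" using unc by auto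
  have cont: "continuous_on \<Phi> sim_ratio"
    unfolding sim_ratio_def by (intro continuous_intros)
  obtain \<phi>0 where \<phi>0: "\<phi>0 \<in> \<Phi>" "\<And>\<phi>. \<phi> \<in> \<Phi> \<Longrightarrow> sim_ratio \<phi>0 \<le> sim_ratio \<phi>"
    using continuous_attains_inf[OF comp ne cont] by blast
  obtain \<phi>1 where \<phi>1: "\<phi>1 \<in> \<Phi>" "\<And>\<phi>. \<phi> \<in> \<Phi> \<Longrightarrow> sim_ratio \<phi> \<le> sim_ratio \<phi>1"
    using continuous_attains_sup[OF comp ne cont] by blast
  define c where "c = sim_ratio \<phi>0"
  have c: "0 < c" "c < 1" unfolding c_def using \<phi>0 con contractionsD by blast+
  have r1: "0 < sim_ratio \<phi>1" "sim_ratio \<phi>1 < 1" using \<phi>1 con contractionsD by blast+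
  obtain m where m: "sim_ratio \<phi>1 ^ m < 1/3"
    using real_arch_pow_inv[of "1/3" "sim_ratio \<phi>1"] r1 by auto
  \<comment> \<open>Odd, so that taking powers is injective, and at least \<open>m\<close>, so that
    the ratios fall below 1/3.\<close>
  define n where "n = 2 * m + 1"
  have n: "odd n" "n > 0" "m \<le> n" by (auto simp: n_def)
  define \<Theta> where "\<Theta> = sim_power n ` \<Phi>"
  have unc\<Theta>: "uncountable \<Theta>"
    unfolding \<Theta>_def using unc con inj_on_sim_power[OF n(1)]
    by (metis countable_image_inj_on inj_on_subset)
  have con\<Theta>: "\<Theta> \<subseteq> contractions"
    unfolding \<Theta>_def using con sim_power_contraction n by blast
  have rat: "c ^ n \<le> sim_ratio \<theta> \<and> sim_ratio \<theta> < 1/3" if \<theta>: "\<theta> \<in> \<Theta>" for \<theta>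
  proof -
    obtain \<phi> where \<phi>: "\<phi> \<in> \<Phi>" "\<theta> = sim_power n \<phi>" using \<theta> unfolding \<Theta>_def by blast
    have r: "0 < sim_ratio \<phi>" using \<phi> con contractionsD by blast
    have "c ^ n \<le> sim_ratio \<phi> ^ n"
      using c \<phi>0(2)[OF \<phi>(1)] by (intro power_mono) (auto simp: c_def)
    moreover have "sim_ratio \<phi> ^ n \<le> sim_ratio \<phi>1 ^ n"
      using r \<phi>1(2)[OF \<phi>(1)] by (intro power_mono) auto
    moreover have "sim_ratio \<phi>1 ^ n \<le> sim_ratio \<phi>1 ^ m"
      using r1 n by (intro power_decreasing) auto
    ultimately show ?thesis using m \<phi>(2) by (simp add: sim_ratio_power)
  qed
  have inv\<Theta>: "sim_map \<theta> ` X \<subseteq> X" if \<theta>: "\<theta> \<in> \<Theta>" for \<theta>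
  proof -
    obtain \<phi> where \<phi>: "\<phi> \<in> \<Phi>" "\<theta> = sim_power n \<phi>" using \<theta> unfolding \<Theta>_def by blast
    have "fst \<phi> \<noteq> 1" using contractionsD[of \<phi>] \<phi> con by auto
    moreover have "(sim_map \<phi> ^^ n) x \<in> X" if "x \<in> X" for x
      using that inv[OF \<phi>(1)] by (induction n) auto
    ultimately show ?thesis using \<phi>(2) sim_map_power by auto
  qed
  show ?thesis
  proof (cases "\<exists>t. uncountable {\<theta>\<in>\<Theta>. fixed_point \<theta> = t}")
    case False
    then show ?thesis
      using that[of \<Theta> "c ^ n"] unc\<Theta> con\<Theta> rat inv\<Theta> c by auto
  next
    case True
    then obtain t where t: "uncountable {\<theta>\<in>\<Theta>. fixed_point \<theta> = t}" (is "uncountable ?T") by blast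
    obtain g where g: "g \<in> \<Phi>" "fixed_point g \<noteq> t" using nofix by blast
    have gc: "g \<in> contractions" using g con by blast
    have inj: "\<theta> = \<theta>'" if "\<theta> \<in> ?T" "\<theta>' \<in> ?T"
      "fixed_point (sim_comp g \<theta>) = fixed_point (sim_comp g \<theta>')" for \<theta> \<theta>'
      using fixed_point_comp_inj[OF gc g(2), of \<theta> \<theta>'] that con\<Theta> by auto
    have rg: "c \<le> sim_ratio g" "sim_ratio g < 1"
      using \<phi>0(2)[OF g(1)] contractionsD[OF gc] by (auto simp: c_def)
    have rat': "c * c ^ n \<le> sim_ratio \<theta> \<and> sim_ratio \<theta> < 1/3" if \<theta>: "\<theta> \<in> sim_comp g ` ?T" for \<theta>
    proof -
      obtain \<theta>' where \<theta>': "\<theta>' \<in> \<Theta>" "\<theta> = sim_comp g \<theta>'" using \<theta> by blast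
      note r = rat[OF \<theta>'(1)]
      have p: "0 < sim_ratio \<theta>'" using r c by (meson zero_less_power less_le_trans)
      have "c * c ^ n \<le> sim_ratio g * sim_ratio \<theta>'"
        using r rg c p by (intro mult_mono) auto
      moreover have "sim_ratio g * sim_ratio \<theta>' \<le> 1 * sim_ratio \<theta>'"
        using rg p by (intro mult_right_mono) auto
      ultimately show ?thesis using r \<theta>'(2) by (simp add: sim_ratio_comp)
    qed
    show ?thesis
    proof (rule that)
      show "uncountable (sim_comp g ` ?T)"
        using t inj by (metis (no_types, lifting) countable_image_inj_on inj_onI)
      show "0 < c * c ^ n" using c by simp
      show "\<forall>\<theta>\<in>sim_comp g ` ?T. c * c ^ n \<le> sim_ratio \<theta> \<and> sim_ratio \<theta> < 1/3"
        using rat' by blast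
      then show "sim_comp g ` ?T \<subseteq> contractions"
        using \<open>0 < c * c ^ n\<close> unfolding contractions_iff subset_eq by fastforce
      show "\<forall>\<theta>\<in>sim_comp g ` ?T. sim_map \<theta> ` X \<subseteq> X"
        using inv[OF g(1)] inv\<Theta> by (force simp: sim_map_comp)
      show "\<forall>u. countable {\<theta> \<in> sim_comp g ` ?T. fixed_point \<theta> = u}"
      proof
        fix u
        \<comment> \<open>Distinct members of the new family have distinct fixed points, so each
          fibre has at most one element.\<close>
        have "\<theta> = \<theta>'" if "\<theta> \<in> {\<theta> \<in> sim_comp g ` ?T. fixed_point \<theta> = u}"
          "\<theta>' \<in> {\<theta> \<in> sim_comp g ` ?T. fixed_point \<theta> = u}" for \<theta> \<theta>'
          using that inj by auto
        then have "\<exists>z. {\<theta> \<in> sim_comp g ` ?T. fixed_point \<theta> = u} \<subseteq> {z}"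
          by blast
        then show "countable {\<theta> \<in> sim_comp g ` ?T. fixed_point \<theta> = u}"
          using countable_subset[of _ "{_}"] by auto
      qed
    qed
  qed
qed

section \<open>The dichotomy between a single point and dimension one\<close>

theorem theorem1:
  assumes overlaps_conjecture:
    "\<forall>\<Psi> Y. finite \<Psi> \<and> \<Psi> \<noteq> {} \<and> \<Psi> \<subseteq> contractions \<and> free_set \<Psi> \<and> is_attractor \<Psi> Y \<longrightarrow>
       hausdorff_dim Y = min 1 (ereal (similarity_dim \<Psi>))"
  shows "\<forall>\<Phi> X. \<Phi> \<subseteq> contractions \<and> compact \<Phi> \<and> uncountable \<Phi> \<and> is_attractor \<Phi> X \<longrightarrow>
       (\<exists>x. X = {x}) \<or> hausdorff_dim X = 1"
proof (intro allI impI)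
  fix \<Phi> X
  assume *: "\<Phi> \<subseteq> contractions \<and> compact \<Phi> \<and> uncountable \<Phi> \<and> is_attractor \<Phi> X"
  then have con: "\<Phi> \<subseteq> contractions" and comp: "compact \<Phi>"
    and unc: "uncountable \<Phi>" and att: "is_attractor \<Phi> X" and ne: "\<Phi> \<noteq> {}" by auto
  have X: "compact X" "X \<noteq> {}" and inv: "\<And>\<phi>. \<phi> \<in> \<Phi> \<Longrightarrow> sim_map \<phi> ` X \<subseteq> X"
    using att unfolding is_attractor_def by blast+
  show "(\<exists>x. X = {x}) \<or> hausdorff_dim X = 1"
  proof (cases "\<exists>t. \<forall>g\<in>\<Phi>. fixed_point g = t")
    case True
    then obtain t where "\<And>g. g \<in> \<Phi> \<Longrightarrow> fixed_point g = t" by blast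
    then have "sim_map g t = t" if "g \<in> \<Phi>" for g
      using sim_map_eq_fixed_point_iff con that by blast
    then have "is_attractor \<Phi> {t}"
      using ne unfolding is_attractor_def by auto
    then show ?thesis using is_attractor_unique[OF con att] by blast
  next
    case False
    then have nofix: "\<And>t. \<exists>g\<in>\<Phi>. fixed_point g \<noteq> t" by blast
    obtain \<Theta> c where \<Theta>: "uncountable \<Theta>" "\<Theta> \<subseteq> contractions" "c > 0"
      "\<forall>\<theta>\<in>\<Theta>. c \<le> sim_ratio \<theta> \<and> sim_ratio \<theta> < 1/3"
      "\<forall>\<theta>\<in>\<Theta>. sim_map \<theta> ` X \<subseteq> X"
      "\<forall>t. countable {\<theta>\<in>\<Theta>. fixed_point \<theta> = t}"
      by (rule uncountable_small_family[OF con comp unc inv nofix])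
    \<comment> \<open>With \<open>n + 1\<close> maps of ratio at least \<open>c\<close> the ratios
      add up to more than 1, which makes the minimum in the overlaps conjecture equal to 1.\<close>
    obtain n where n: "1 / c < real n" using reals_Archimedean2 by blast
    obtain S where S: "S \<subseteq> \<Theta>" "finite S" "card S = Suc n" "free_set S"
      using large_free_subset[OF \<Theta>(1,2) _ \<Theta>(6)[rule_format], of n] \<Theta>(4) by blast
    have Sne: "S \<noteq> {}" using S by auto
    have Scon: "S \<subseteq> contractions" using S \<Theta> by blast
    obtain Y where Y: "is_attractor S Y" "Y \<subseteq> X"
      using finite_attractor_subset[OF S(2) Sne Scon X] S \<Theta>(5) by blast
    have "1 \<le> real (card S) * c"
      using n S(3) \<Theta>(3) by (simp add: field_simps)
    also have "\<dots> \<le> (\<Sum>\<psi>\<in>S. sim_ratio \<psi>)"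
      using S \<Theta>(4) by (intro sum_bounded_below) auto
    finally have "similarity_dim S \<ge> 1"
      using similarity_dim_ge_1 S Sne Scon by blast
    moreover have "hausdorff_dim Y = min 1 (ereal (similarity_dim S))"
      using overlaps_conjecture S Sne Scon Y by blast
    ultimately have "hausdorff_dim Y = 1"
      by (simp add: min_def one_ereal_def)
    then have "1 \<le> hausdorff_dim X"
      using hausdorff_dim_mono[OF Y(2)] by simp
    then show ?thesis
      using hausdorff_dim_le_1[OF compact_imp_bounded[OF X(1)]] by auto
  qed
qed

end
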